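(* Let $\mathcal{T}=(\Sigma,\Delta,\sigma^0,\Lambda)$ be a concrete causal transition system with trace set $\mathsf{Tr}$, and let $\varphi_c,\varphi_e$ be causal formulas. Suppose Algorithm 1 (abstraction–refinement, described in the context) returns $\varphi_c$; that is, for an under-approximate trace set $\check{\mathsf{Tr}}\subseteq\mathsf{Tr}$ and an over-approximate causal transition system $\hat{\mathcal{T}}$ with trace set $\hat{\mathsf{Tr}}$ (both as described in the context): (i) AC1 holds in $\check{\mathsf{Tr}}$: there is $\check\tau\in\check{\mathsf{Tr}}$ with $\check\tau\models \neg\varphi_e\,\mathcal{U}\,(\varphi_c\wedge\Diamond\varphi_e)$; (ii) AC2(a) holds in $\check{\mathsf{Tr}}$: there is $\check\tau'\in\check{\mathsf{Tr}}$ with $\check\tau'\models\Box(\neg\varphi_c\wedge\neg\varphi_e)$ and ($\check\tau\not\equiv_Z\check\tau'$ or $\check\tau\not\equiv_W\check\tau'$); (iii) AC2(b) holds in $\hat{\mathcal{T}}$: for every $\hat\tau''\in\hat{\mathsf{Tr}}$, if $\hat\tau''\models\neg\varphi_e\,\mathcal{U}\,\varphi_c$ and $\check\tau\equiv_Z\hat\tau''$ and $\check\tau\not\equiv_W\hat\tau''$, then $\hat\tau''\models\Diamond\varphi_e$. Then $\varphi_c$ is an actual cause of $\varphi_e$ in $\mathcal{T}$, i.e.: AC1: there exists $\tau\in\mathsf{Tr}$ with $\tau\models\neg\varphi_e\,\mathcal{U}\,(\varphi_c\wedge\Diamond\varphi_e)$; AC2(a): there exists $\tau'\in\mathsf{Tr}$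 with $\tau'\models\Box(\neg\varphi_c\wedge\neg\varphi_e)$ and ($\tau\not\equiv_Z\tau'$ or $\tau\not\equiv_W\tau'$); AC2(b): for all $\tau''\in\mathsf{Tr}$, if $\tau''\models\neg\varphi_e\,\mathcal{U}\,\varphi_c$ and $\tau\equiv_Z\tau''$ and $\tau\not\equiv_W\tau''$, then $\tau''\models\Diamond\varphi_e$.
   Context: A causal model has exogenous variables $\mathcal{U}$, endogenous variables $\mathcal{V}$, each variable $Y$ ranging over a nonempty set $\mathcal{R}(Y)$; a state is a valuation of the variables. A causal transition system $\mathcal{T}=(\Sigma,\Delta,\sigma^0,\Lambda)$ has state set $\Sigma$ (valuations of $\mathcal{U}\cup\mathcal{V}$), transition relation $\Delta$ (given by the structural equations, acyclic), initial state $\sigma^0$ fixed by the context (values of exogenous variables), and labelling $\Lambda$ assigning to states atomic propositions from a set $\mathsf{AP}$ (given by causal formulas, i.e. Boolean combinations of primitive events $X=x$). A path is $\sigma_0\sigma_1\ldots$ with $\sigma_0=\sigma^0$ and $(\sigma_i,\sigma_{i+1})\in\Delta$; its trace is $\Lambda(\sigma_0)\Lambda(\sigma_1)\ldots$, and $\mathsf{Tr}$ is the set of all traces. For a state formula $p$: $\tau\models\Box p$ iff $\tau_i\models p$ for all $i\ge0$; $\tau\models\Diamond p$ iff $\tau_i\models p$ for some $i\ge0$; $\tau\models p\,\mathcal{U}\,q$ iff there is $i\ge0$ with $\tau_i\models q$ and $\tau_j\models p$ for all $j<i$. The endogenous variables are partitioned into disjoint sets $Z$ (the causal path, containing the variables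 of the cause) and $W$; for traces $\tau,\tau'$, $\tau\equiv_Z\tau'$ means they agree on the values of all variables in $Z$ at every position (similarly $\equiv_W$). Algorithm 1 works as follows. The under-approximation $\check{\mathsf{Tr}}$ is a subset of $\mathsf{Tr}$ (chosen by a mapping $\check h$ with $\check h(\mathsf{Tr})\subseteq\mathsf{Tr}$, enlarged during refinement); an SMT query on $\check{\mathsf{Tr}}$ for AC1 $\wedge$ AC2(a) yields $\varphi_c$ and witnesses $\check\tau,\check\tau'$. Then an over-approximation $\hat{\mathcal{T}}=(\hat\Sigma,\hat\Delta,\hat\sigma^0,\hat\Lambda)$ is built from an over-approximation state mapping $\hat h$ sending concrete states to abstract states (merging nearby states, possibly adding states not in $\Sigma$), so that every concrete trace $\tau''$ is mapped to an abstract trace $\hat\tau''\in\hat{\mathsf{Tr}}$, the abstraction preserves state valuations and the truth of $\varphi_c,\varphi_e$ at corresponding states; and (Assumption 1) $\hat h$ preserves $Z$-equality of traces: for concrete transitions $(\sigma_0,\sigma_1),(\sigma_0',\sigma_1')$, if $\sigma_0\equiv_Z\sigma_0'$ and $\sigma_1\not\equiv_Z\sigma_1'$ then $\sigma_0\equiv_Z\hat h(\sigma_0')$ and $\sigma_1\not\equiv_Z\hat h(\sigma_1')$. An SMT query checks AC2(b) on $\hat{\mathcal{T}}$; if it fails, $\hat{\mathcal{T}}$ is refined by removing counterexample states in $\hat\Sigma$ not corresponding to $\Sigma$ (or $\check{\mathsf{Tr}}$ is enlarged), and upon success $\varphi_c$ is returned. The minimality condition AC3 is omitted from the notion of actual cause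 here. *)

theory Defs
  imports "HOL-Library.FuncSet" "HOL-Library.Linear_Temporal_Logic_on_Streams"
begin

datatype ('v, 'a) cformula =
    Event 'v 'a
  | Neg "('v, 'a) cformula"
  | Conj "('v, 'a) cformula" "('v, 'a) cformula"
  | Disj "('v, 'a) cformula" "('v, 'a) cformula"

primrec sat :: "('v \<Rightarrow> 'a) \<Rightarrow> ('v, 'a) cformula \<Rightarrow> bool" where
  "sat \<sigma> (Event X x) \<longleftrightarrow> \<sigma> X = x"
| "sat \<sigma> (Neg p) \<longleftrightarrow> \<not> sat \<sigma> p"
| "sat \<sigma> (Conj p q) \<longleftrightarrow> sat \<sigma> p \<and> sat \<sigma> q"
| "sat \<sigma> (Disj p q) \<longleftrightarrow> sat \<sigma> p \<or> sat \<sigma> q"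

primrec events :: "('v, 'a) cformula \<Rightarrow> ('v \<times> 'a) set" where
  "events (Event X x) = {(X, x)}"
| "events (Neg p) = events p"
| "events (Conj p q) = events p \<union> events q"
| "events (Disj p q) = events p \<union> events q"

text \<open>
  The set \<open>eqs M X \<sigma> \<sigma>'\<close> holds the values that the structural equation of \<open>X\<close> admits for \<open>X\<close>
  in the state \<open>\<sigma>'\<close> reached from \<open>\<sigma>\<close>.  A deterministic equation is a singleton.  Sets are used
  because the initial state is fixed, so that equations with a unique solution would leave a
  single trace and no counterfactual one.
\<close>

record ('v, 'a) causal_model =
  exo :: "'v set"
  endo :: "'v set"
  rng :: "'v \<Rightarrow> 'a set"
  eqs :: "'v \<Rightarrow> ('v \<Rightarrow> 'a) \<Rightarrow> ('v \<Rightarrow> 'a) \<Rightarrow> 'a set"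

definition valuations :: "('v, 'a) causal_model \<Rightarrow> ('v \<Rightarrow> 'a) set" where
  "valuations M = Pi\<^sub>E (exo M \<union> endo M) (rng M)"

definition causal_formulas :: "('v, 'a) causal_model \<Rightarrow> ('v, 'a) cformula set" where
  "causal_formulas M = {p. events p \<subseteq> Sigma (endo M) (rng M)}"

text \<open>
  Acyclicity concerns dependencies within one time step; the new value of a variable may depend
  on the previous value of any variable, itself included.
\<close>

definition depends_on :: "('v, 'a) causal_model \<Rightarrow> 'v \<Rightarrow> 'v \<Rightarrow> bool" where
  "depends_on M X Y \<longleftrightarrow>
     (\<exists>\<sigma>\<in>valuations M. \<exists>\<sigma>1\<in>valuations M. \<exists>\<sigma>2\<in>valuations M.
        (\<forall>V. V \<noteq> Y \<longrightarrow> \<sigma>1 V = \<sigma>2 V) \<and> eqs M X \<sigma> \<sigma>1 \<noteq> eqs M X \<sigma> \<sigma>2)"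

definition wf_causal_model :: "('v, 'a) causal_model \<Rightarrow> bool" where
  "wf_causal_model M \<longleftrightarrow>
     exo M \<inter> endo M = {} \<and>
     (\<forall>Y\<in>exo M \<union> endo M. rng M Y \<noteq> {}) \<and>
     (\<forall>X\<in>endo M. \<forall>\<sigma>\<in>valuations M. \<forall>\<sigma>'\<in>valuations M. eqs M X \<sigma> \<sigma>' \<subseteq> rng M X) \<and>
     acyclic {(Y, X). X \<in> endo M \<and> Y \<in> endo M \<and> depends_on M X Y}"

record ('s, 'p) transition_system =
  states :: "'s set"
  steps :: "('s \<times> 's) set"
  start :: "'s"
  lab :: "'s \<Rightarrow> 'p set"

definition wf_transition_system :: "'p set \<Rightarrow> ('s, 'p) transition_system \<Rightarrow> bool" where
  "wf_transition_system AP T \<longleftrightarrow>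
     steps T \<subseteq> states T \<times> states T \<and> start T \<in> states T \<and> (\<forall>s\<in>states T. lab T s \<subseteq> AP)"

definition paths :: "('s, 'p) transition_system \<Rightarrow> 's stream set" where
  "paths T = {\<pi>. \<pi> !! 0 = start T \<and> (\<forall>i. (\<pi> !! i, \<pi> !! Suc i) \<in> steps T)}"

definition traces :: "('s, 'p) transition_system \<Rightarrow> 'p set stream set" where
  "traces T = smap (lab T) ` paths T"

text \<open>
  The atomic propositions are all causal formulas of the model; \<open>u\<close> is the context, i.e. the
  values of the exogenous variables, which no transition changes.
\<close>

definition causal_transition_system ::
    "('v, 'a) causal_model \<Rightarrow> ('v \<Rightarrow> 'a) \<Rightarrow>
     ('v \<Rightarrow> 'a, ('v, 'a) cformula) transition_system \<Rightarrow> bool" where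
  "causal_transition_system M u T \<longleftrightarrow>
     wf_causal_model M \<and>
     wf_transition_system (causal_formulas M) T \<and>
     states T \<subseteq> valuations M \<and>
     steps T = {(\<sigma>, \<sigma>'). \<sigma> \<in> states T \<and> \<sigma>' \<in> states T \<and>
                  (\<forall>Y\<in>exo M. \<sigma>' Y = \<sigma> Y) \<and> (\<forall>X\<in>endo M. \<sigma>' X \<in> eqs M X \<sigma> \<sigma>')} \<and>
     u \<in> Pi\<^sub>E (exo M) (rng M) \<and>
     (\<forall>Y\<in>exo M. start T Y = u Y) \<and>
     (\<forall>\<sigma>\<in>states T. lab T \<sigma> = {p \<in> causal_formulas M. sat \<sigma> p})"

text \<open>
  A trace is a sequence of labels, and the value of a variable at a position is read off from
  the primitive events in the label; the lemma after the definitions relates this to states.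
\<close>

definition agree_on :: "'v set \<Rightarrow> ('v, 'a) cformula set \<Rightarrow> ('v, 'a) cformula set \<Rightarrow> bool" where
  "agree_on Z L L' \<longleftrightarrow> (\<forall>X\<in>Z. \<forall>x. Event X x \<in> L \<longleftrightarrow> Event X x \<in> L')"

definition trace_eq ::
    "'v set \<Rightarrow> ('v, 'a) cformula set stream \<Rightarrow> ('v, 'a) cformula set stream \<Rightarrow> bool" where
  "trace_eq Z \<tau> \<tau>' \<longleftrightarrow> (\<forall>i. agree_on Z (\<tau> !! i) (\<tau>' !! i))"

lemma agree_on_lab_iff:
  assumes "causal_transition_system M u T" "Z \<subseteq> endo M" "\<sigma> \<in> states T" "\<sigma>' \<in> states T"
  shows "agree_on Z (lab T \<sigma>) (lab T \<sigma>') \<longleftrightarrow> (\<forall>X\<in>Z. \<sigma> X = \<sigma>' X)"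
proof -
  have "\<sigma> \<in> valuations M" "\<sigma>' \<in> valuations M"
    using assms by (auto simp: causal_transition_system_def)
  then have "\<sigma> X \<in> rng M X \<and> \<sigma>' X \<in> rng M X" if "X \<in> Z" for X
    using that assms(2) by (auto simp: valuations_def PiE_iff)
  then show ?thesis
    using assms by (fastforce simp: causal_transition_system_def agree_on_def causal_formulas_def)
qed

text \<open>
  The strong until of the library is \<open>suntil\<close> (\<open>until\<close> is the weak one).
\<close>

lemma suntil_iff_sdrop:
  "(\<phi> suntil \<psi>) \<tau> \<longleftrightarrow> (\<exists>i. \<psi> (sdrop i \<tau>) \<and> (\<forall>j<i. \<phi> (sdrop j \<tau>)))"
proof
  assume "(\<phi> suntil \<psi>) \<tau>"
  then show "\<exists>i. \<psi> (sdrop i \<tau>) \<and> (\<forall>j<i. \<phi> (sdrop j \<tau>))"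
  proof (induction rule: suntil.induct)
    case (base \<tau>)
    then show ?case by (intro exI[of _ 0]) simp
  next
    case (step \<tau>)
    then obtain i where i: "\<psi> (sdrop i (stl \<tau>))" "\<forall>j<i. \<phi> (sdrop j (stl \<tau>))" by blast
    have "\<phi> (sdrop j \<tau>)" if "j < Suc i" for j
      using that i step.hyps by (cases j) auto
    then show ?case using i by (intro exI[of _ "Suc i"]) simp
  qed
next
  assume "\<exists>i. \<psi> (sdrop i \<tau>) \<and> (\<forall>j<i. \<phi> (sdrop j \<tau>))"
  then obtain i where "\<psi> (sdrop i \<tau>)" "\<forall>j<i. \<phi> (sdrop j \<tau>)" by blast
  then show "(\<phi> suntil \<psi>) \<tau>"
  proof (induction i arbitrary: \<tau>)
    case 0
    then show ?case by (auto intro: suntil.base)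
  next
    case (Suc i)
    have "(\<phi> suntil \<psi>) (stl \<tau>)"
      using Suc.prems by (intro Suc.IH) (auto dest: spec[of _ "Suc _"])
    moreover have "\<phi> \<tau>" using Suc.prems(2) by force
    ultimately show ?case by (rule suntil.step[rotated])
  qed
qed

abbreviation atom :: "'p \<Rightarrow> 'p set stream \<Rightarrow> bool" where
  "atom p \<equiv> holds (\<lambda>L. p \<in> L)"

definition AC1 ::
    "('v, 'a) cformula set stream set \<Rightarrow> ('v, 'a) cformula \<Rightarrow> ('v, 'a) cformula \<Rightarrow>
     ('v, 'a) cformula set stream \<Rightarrow> bool" where
  "AC1 Tr \<phi>c \<phi>e \<tau> \<longleftrightarrow>
     \<tau> \<in> Tr \<and> (not (atom \<phi>e) suntil (atom \<phi>c aand ev (atom \<phi>e))) \<tau>"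

definition AC2a ::
    "('v, 'a) cformula set stream set \<Rightarrow> 'v set \<Rightarrow> 'v set \<Rightarrow>
     ('v, 'a) cformula \<Rightarrow> ('v, 'a) cformula \<Rightarrow> ('v, 'a) cformula set stream \<Rightarrow> bool" where
  "AC2a Tr Z W \<phi>c \<phi>e \<tau> \<longleftrightarrow>
     (\<exists>\<tau>'\<in>Tr. alw (not (atom \<phi>c) aand not (atom \<phi>e)) \<tau>' \<and>
        (\<not> trace_eq Z \<tau> \<tau>' \<or> \<not> trace_eq W \<tau> \<tau>'))"

definition AC2b ::
    "('v, 'a) cformula set stream set \<Rightarrow> 'v set \<Rightarrow> 'v set \<Rightarrow>
     ('v, 'a) cformula \<Rightarrow> ('v, 'a) cformula \<Rightarrow> ('v, 'a) cformula set stream \<Rightarrow> bool" where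
  "AC2b Tr Z W \<phi>c \<phi>e \<tau> \<longleftrightarrow>
     (\<forall>\<tau>''\<in>Tr. (not (atom \<phi>e) suntil atom \<phi>c) \<tau>'' \<and> trace_eq Z \<tau> \<tau>'' \<and> \<not> trace_eq W \<tau> \<tau>''
        \<longrightarrow> ev (atom \<phi>e) \<tau>'')"

text \<open>The minimality condition AC3 is not part of this notion.\<close>

definition actual_cause ::
    "('s, ('v, 'a) cformula) transition_system \<Rightarrow> 'v set \<Rightarrow> 'v set \<Rightarrow>
     ('v, 'a) cformula \<Rightarrow> ('v, 'a) cformula \<Rightarrow> bool" where
  "actual_cause T Z W \<phi>c \<phi>e \<longleftrightarrow>
     (\<exists>\<tau>. AC1 (traces T) \<phi>c \<phi>e \<tau> \<and> AC2a (traces T) Z W \<phi>c \<phi>e \<tau> \<and> AC2b (traces T) Z W \<phi>c \<phi>e \<tau>)"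

text \<open>
  Abstract states may be of any type, so that \<open>h\<close> can merge states and there can be abstract
  states outside its image.  The last two conjuncts say that \<open>h\<close> preserves the values of the
  endogenous variables and the truth of the two formulas.
\<close>

definition over_approximation ::
    "('v, 'a) causal_model \<Rightarrow> ('v \<Rightarrow> 'a, ('v, 'a) cformula) transition_system \<Rightarrow>
     ('s, ('v, 'a) cformula) transition_system \<Rightarrow> (('v \<Rightarrow> 'a) \<Rightarrow> 's) \<Rightarrow>
     ('v, 'a) cformula \<Rightarrow> ('v, 'a) cformula \<Rightarrow> bool" where
  "over_approximation M T T' h \<phi>c \<phi>e \<longleftrightarrow>
     wf_transition_system (causal_formulas M) T' \<and>
     h \<in> states T \<rightarrow> states T' \<and>
     (\<forall>\<pi>\<in>paths T. smap h \<pi> \<in> paths T') \<and>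
     (\<forall>\<sigma>\<in>states T. agree_on (endo M) (lab T \<sigma>) (lab T' (h \<sigma>))) \<and>
     (\<forall>\<sigma>\<in>states T. \<forall>p\<in>{\<phi>c, \<phi>e}. p \<in> lab T \<sigma> \<longleftrightarrow> p \<in> lab T' (h \<sigma>))"

definition preserves_Z_equality ::
    "(('v \<Rightarrow> 'a), ('v, 'a) cformula) transition_system \<Rightarrow>
     ('s, ('v, 'a) cformula) transition_system \<Rightarrow> (('v \<Rightarrow> 'a) \<Rightarrow> 's) \<Rightarrow> 'v set \<Rightarrow> bool" where
  "preserves_Z_equality T T' h Z \<longleftrightarrow>
     (\<forall>(\<sigma>0, \<sigma>1)\<in>steps T. \<forall>(\<sigma>0', \<sigma>1')\<in>steps T.
        agree_on Z (lab T \<sigma>0) (lab T \<sigma>0') \<and> \<not> agree_on Z (lab T \<sigma>1) (lab T \<sigma>1') \<longrightarrow>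
        agree_on Z (lab T \<sigma>0) (lab T' (h \<sigma>0')) \<and> \<not> agree_on Z (lab T \<sigma>1) (lab T' (h \<sigma>1')))"

end

theory Submission
  imports Defs
begin

text \<open>
  The witnesses \<open>\<tau>\<close>, \<open>\<tau>'\<close> of the under-approximation are concrete traces, so AC1 and AC2(a)
  transfer at once. For AC2(b), a concrete trace and its image under \<open>h\<close> agree position by
  position on the endogenous values and on the truth of the two formulas, so the concrete trace
  satisfies each hypothesis and the conclusion of AC2(b) exactly if its image does.
\<close>

text \<open>The initial state covers position 0; any later position is the target of a step.\<close>

lemma path_in_states:
  assumes "wf_transition_system AP T" "\<pi> \<in> paths T"
  shows "\<pi> !! i \<in> states T"
  using assms by (cases i) (auto simp: wf_transition_system_def paths_def)

lemma agree_on_mono: "agree_on V L L' \<Longrightarrow> Z \<subseteq> V \<Longrightarrow> agree_on Z L L'"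
  by (auto simp: agree_on_def)

text \<open>An equivalence rather than an implication, since AC2(b) uses trace equality positively
  for \<open>Z\<close> and negated for \<open>W\<close>.\<close>

lemma trace_eq_cong_right:
  assumes "trace_eq Z \<tau>1 \<tau>2"
  shows "trace_eq Z \<tau> \<tau>1 \<longleftrightarrow> trace_eq Z \<tau> \<tau>2"
  using assms by (auto simp: trace_eq_def agree_on_def)

text \<open>An \<open>atom\<close> inspects only the head of a suffix, and the head of
  \<open>sdrop i \<tau>\<close> is \<open>\<tau> !! i\<close>.\<close>

lemma ev_atom_cong:
  assumes "\<And>i. p \<in> \<tau>1 !! i \<longleftrightarrow> p \<in> \<tau>2 !! i"
  shows "ev (atom p) \<tau>1 \<longleftrightarrow> ev (atom p) \<tau>2"
  using assms by (simp add: ev_iff_sdrop)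

lemma not_suntil_atom_cong:
  assumes "\<And>i. p \<in> \<tau>1 !! i \<longleftrightarrow> p \<in> \<tau>2 !! i" "\<And>i. q \<in> \<tau>1 !! i \<longleftrightarrow> q \<in> \<tau>2 !! i"
  shows "(not (atom q) suntil atom p) \<tau>1 \<longleftrightarrow> (not (atom q) suntil atom p) \<tau>2"
  using assms by (simp add: suntil_iff_sdrop)

text \<open>AC1 and AC2(a) use the trace set only as a place where witnesses live, so enlarging it
  is harmless; AC2(b) is universal and passes to smaller sets instead.\<close>

lemma AC1_mono: "AC1 A \<phi>c \<phi>e \<tau> \<Longrightarrow> A \<subseteq> B \<Longrightarrow> AC1 B \<phi>c \<phi>e \<tau>"
  by (auto simp: AC1_def)

lemma AC2a_mono: "AC2a A Z W \<phi>c \<phi>e \<tau> \<Longrightarrow> A \<subseteq> B \<Longrightarrow> AC2a B Z W \<phi>c \<phi>e \<tau>"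
  unfolding AC2a_def by blast

lemma AC2b_over_approximation:
  assumes wf: "wf_transition_system AP T"
    and over: "over_approximation M T T' h \<phi>c \<phi>e"
    and sub: "Z \<subseteq> endo M" "W \<subseteq> endo M"
    and AC2b: "AC2b (traces T') Z W \<phi>c \<phi>e \<tau>"
  shows "AC2b (traces T) Z W \<phi>c \<phi>e \<tau>"
  unfolding AC2b_def
proof (intro ballI impI)
  fix \<tau>1
  assume "\<tau>1 \<in> traces T"
    and prems: "(not (atom \<phi>e) suntil atom \<phi>c) \<tau>1 \<and> trace_eq Z \<tau> \<tau>1 \<and> \<not> trace_eq W \<tau> \<tau>1"
  then obtain \<pi> where \<pi>: "\<pi> \<in> paths T" and \<tau>1: "\<tau>1 = smap (lab T) \<pi>"
    by (auto simp: traces_def)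
  \<comment> \<open>\<open>h\<close> acts on states, not on labels, so the abstract trace is built
    from a path underlying \<open>\<tau>1\<close>.\<close>
  define \<tau>2 where "\<tau>2 = smap (lab T') (smap h \<pi>)"
  have "\<tau>2 \<in> traces T'"
    using over \<pi> by (auto simp: over_approximation_def traces_def \<tau>2_def)
  have states: "\<pi> !! i \<in> states T" for i
    using wf \<pi> by (rule path_in_states)
  have atoms: "p \<in> \<tau>1 !! i \<longleftrightarrow> p \<in> \<tau>2 !! i" if "p \<in> {\<phi>c, \<phi>e}" for p i
    using over states[of i] that by (auto simp: over_approximation_def \<tau>1 \<tau>2_def)
  have "agree_on (endo M) (\<tau>1 !! i) (\<tau>2 !! i)" for i
    using over states[of i] by (auto simp: over_approximation_def \<tau>1 \<tau>2_def)
  then have "trace_eq V \<tau>1 \<tau>2" if "V \<subseteq> endo M" for V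
    using that by (auto simp: trace_eq_def intro: agree_on_mono)
  \<comment> \<open>The case \<open>V = Z\<close> carries the agreement over to
    \<open>\<tau>2\<close>, the case \<open>V = W\<close> the disagreement.\<close>
  then have "trace_eq Z \<tau> \<tau>2" "\<not> trace_eq W \<tau> \<tau>2"
    using prems sub trace_eq_cong_right by blast+
  moreover have "(not (atom \<phi>e) suntil atom \<phi>c) \<tau>2"
    using prems not_suntil_atom_cong[of \<phi>c \<tau>1 \<tau>2 \<phi>e] atoms by simp
  ultimately have "ev (atom \<phi>e) \<tau>2"
    using AC2b \<open>\<tau>2 \<in> traces T'\<close> by (simp add: AC2b_def)
  then show "ev (atom \<phi>e) \<tau>1"
    using ev_atom_cong[of \<phi>e \<tau>1 \<tau>2] atoms by simp
qed

theorem theorem1: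
  fixes M :: "('v, 'a) causal_model"
    and u :: "'v \<Rightarrow> 'a"
    and T :: "('v \<Rightarrow> 'a, ('v, 'a) cformula) transition_system"
    and Z W :: "'v set"
    and \<phi>c \<phi>e :: "('v, 'a) cformula"
    and Tr_under :: "('v, 'a) cformula set stream set"
    and T_over :: "('s, ('v, 'a) cformula) transition_system"
    and h :: "('v \<Rightarrow> 'a) \<Rightarrow> 's"
    and \<tau> :: "('v, 'a) cformula set stream"
  assumes "causal_transition_system M u T"
    and "\<phi>c \<in> causal_formulas M" and "\<phi>e \<in> causal_formulas M"
    and "Z \<union> W = endo M" and "Z \<inter> W = {}" and "fst ` events \<phi>c \<subseteq> Z"
    and "Tr_under \<subseteq> traces T"
    and "over_approximation M T T_over h \<phi>c \<phi>e"
    and "preserves_Z_equality T T_over h Z"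
    and "AC1 Tr_under \<phi>c \<phi>e \<tau>"
    and "AC2a Tr_under Z W \<phi>c \<phi>e \<tau>"
    and "AC2b (traces T_over) Z W \<phi>c \<phi>e \<tau>"
  shows "actual_cause T Z W \<phi>c \<phi>e"
proof -
  have "wf_transition_system (causal_formulas M) T"
    using assms(1) by (simp add: causal_transition_system_def)
  moreover have "Z \<subseteq> endo M" "W \<subseteq> endo M"
    using assms(4) by auto
  ultimately have "AC2b (traces T) Z W \<phi>c \<phi>e \<tau>"
    using assms(8,12) by (blast intro: AC2b_over_approximation)
  \<comment> \<open>The same \<open>\<tau>\<close> witnesses all three conditions.\<close>
  then show ?thesis
    using AC1_mono[OF assms(10,7)] AC2a_mono[OF assms(11,7)]
    unfolding actual_cause_def by blast
qed

end
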